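(* Let $n\in\mathbb{N}$ and let $k_i,m_i\in\mathbb{N}$ for $1\le i\le n$. Let $\alpha\in\mathbb{Q}$. If $$0^{k_1}1^{m_1}0^{k_2}1^{m_2}\cdots 0^{k_n}1^{m_n}(\alpha)=1,$$ then $$\alpha=\left[\frac{2}{3}\right]^{m_{n}}\left(2^{k_{n}}\left(\left[\frac{2}{3}\right]^{m_{n-1}}\left(2^{k_{n-1}}\left(\cdots\left(\left[\frac{2}{3}\right]^{m_{1}}\left(2^{k_{1}}+1\right)-1\right)\cdots\right)+1\right)-1\right)+1\right)-1.$$ That is, $\alpha=\alpha_n$, where $\alpha_0=1$ and $\alpha_i=\left[\frac{2}{3}\right]^{m_i}\left(2^{k_i}\alpha_{i-1}+1\right)-1$ for $1\le i\le n$.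
   Context: $\mathbb{N}=\{1,2,3,\ldots\}$. The symbols $0$ and $1$, when used as letters in a word applied to a number, denote the maps $0:x\mapsto \frac{x}{2}$ and $1:x\mapsto\frac{3x+1}{2}$, here regarded as maps $\mathbb{Q}\to\mathbb{Q}$. Words denote compositions read from right to left: $s_k s_{k-1}\cdots s_1(x)=s_k\circ s_{k-1}\circ\cdots\circ s_1(x)$ (the rightmost letter is applied first), and $s^k$ denotes the $k$-fold composition of $s$ with itself. Thus in $0^{k_1}1^{m_1}\cdots 0^{k_n}1^{m_n}(\alpha)$ one first applies the map $1$ exactly $m_n$ times to $\alpha$, then the map $0$ exactly $k_n$ times, and so on, ending with $k_1$ applications of $0$. Square brackets are ordinary parentheses. *)

theory Defs
  imports Complex_Main
begin

text \<open>The letters \<open>0\<close> and \<open>1\<close> of the paper, as maps on the rationals.\<close>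

definition letter0 :: "rat \<Rightarrow> rat" where
  "letter0 x = x / 2"

definition letter1 :: "rat \<Rightarrow> rat" where
  "letter1 x = (3 * x + 1) / 2"

text \<open>
  The word \<open>0^(k 1) 1^(m 1) 0^(k 2) 1^(m 2) ... 0^(k n) 1^(m n)\<close> as the composition of its letters.
  Words are read from right to left: the first map applied is \<open>letter1\<close>, \<open>m n\<close> times.
\<close>

definition word_map :: "(nat \<Rightarrow> nat) \<Rightarrow> (nat \<Rightarrow> nat) \<Rightarrow> nat \<Rightarrow> rat \<Rightarrow> rat" where
  "word_map k m n =
     foldr (\<circ>) (map (\<lambda>i. (letter0 ^^ k i) \<circ> (letter1 ^^ m i)) [1..<n + 1]) id"

text \<open>The nested expression on the right-hand side; the innermost value is \<open>1\<close>.\<close>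

primrec alpha_seq :: "(nat \<Rightarrow> nat) \<Rightarrow> (nat \<Rightarrow> nat) \<Rightarrow> nat \<Rightarrow> rat" where
  "alpha_seq k m 0 = 1"
| "alpha_seq k m (Suc i) =
     (2 / 3) ^ m (Suc i) * (2 ^ k (Suc i) * alpha_seq k m i + 1) - 1"

end

theory Submission
  imports Defs
begin

text \<open>
  The map \<open>1\<close> is conjugate, by the shift \<open>x \<mapsto> x + 1\<close>, to multiplication by \<open>3/2\<close>, so each block
  \<open>0^k 1^m\<close> can be inverted explicitly. The blocks are peeled off from the left: the value that the
  last block has to produce is determined by the first \<open>n - 1\<close> blocks.
\<close>

lemma letter0_funpow: "(letter0 ^^ k) x = x / 2 ^ k"
  by (induction k) (simp_all add: letter0_def)

lemma letter1_funpow: "(letter1 ^^ m) x = (3 / 2) ^ m * (x + 1) - 1"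
  by (induction m) (simp_all add: letter1_def field_simps)

text \<open>Stated as an equivalence solved for \<open>x\<close>, with the right-hand side in the
  shape of the recursion step of \<open>alpha_seq\<close>.\<close>

lemma block_eq_iff:
  "(letter0 ^^ k) ((letter1 ^^ m) x) = y \<longleftrightarrow> x = (2 / 3) ^ m * (2 ^ k * y + 1) - 1"
  by (auto simp: letter0_funpow letter1_funpow field_simps)

text \<open>Appending a block at the right end of the list puts it in place of the start value
  \<open>id\<close>; associativity moves it out of the fold.\<close>

lemma foldr_comp_conv_id: "foldr (\<circ>) fs g = foldr (\<circ>) fs id \<circ> g"
  by (induction fs) (simp_all add: comp_assoc)

lemma word_map_Suc:
  "word_map k m (Suc n) x = word_map k m n ((letter0 ^^ k (Suc n)) ((letter1 ^^ m (Suc n)) x))"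
  unfolding word_map_def
  by (simp add: foldr_comp_conv_id[of _ "(letter0 ^^ k (Suc n)) \<circ> (letter1 ^^ m (Suc n))"])

lemma word_map_eq_1_iff: "word_map k m n x = 1 \<longleftrightarrow> x = alpha_seq k m n"
\<comment> \<open>\<open>x\<close> must vary: the induction hypothesis is used at the image of
  \<open>x\<close> under the last block.\<close>
proof (induction n arbitrary: x)
  case 0
  show ?case by (simp add: word_map_def)
next
  case (Suc n)
  show ?case by (simp add: word_map_Suc Suc.IH block_eq_iff)
qed

theorem theorem3p1:
  fixes n :: nat and k m :: "nat \<Rightarrow> nat" and \<alpha> :: rat
  assumes "n \<ge> 1"
    and "\<And>i. 1 \<le> i \<Longrightarrow> i \<le> n \<Longrightarrow> k i \<ge> 1"
    and "\<And>i. 1 \<le> i \<Longrightarrow> i \<le> n \<Longrightarrow> m i \<ge> 1"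
    and "word_map k m n \<alpha> = 1"
  shows "\<alpha> = alpha_seq k m n"
  using assms(4) by (simp add: word_map_eq_1_iff)

end
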